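(* Let $d\mu$ be a nontrivial normalized $d\times d$ matrix-valued measure on $\partial\mathbb{D}$, with normalized left and right orthogonal polynomials $\varphi_n^L,\varphi_n^R$, and define for integers $m$ the Laurent polynomials $$\chi_{2m}(z)=z^{-m}(\varphi_{2m}^R)^*(z)\ (m\ge0),\qquad \chi_{2m-1}(z)=z^{-m+1}\varphi_{2m-1}^L(z)\ (m\ge 1),$$ $$x_{2m}(z)=z^{-m}\varphi_{2m}^L(z)\ (m\ge0),\qquad x_{2m-1}(z)=z^{-m}(\varphi_{2m-1}^R)^*(z)\ (m\ge1).$$ Then $\{\chi_\ell\}_{\ell=0}^\infty$ and $\{x_\ell\}_{\ell=0}^\infty$ are $\langle\!\langle\cdot,\cdot\rangle\!\rangle_L$-orthonormal, that is, for all $\ell,m\ge 0$, $$\langle\!\langle\chi_\ell,\chi_m\rangle\!\rangle_L=\delta_{\ell m}\mathbf{1},\qquad \langle\!\langle x_\ell,x_m\rangle\!\rangle_L=\delta_{\ell m}\mathbf{1}.$$ Moreover, $\chi_\ell$ is in the module span of the first $\ell+1$ of $1,z,z^{-1},z^2,z^{-2},\dots$, and $x_\ell$ is in the module span of the first $\ell+1$ of $1,z^{-1},z,z^{-2},z^2,\dots$.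
   Context: Let $\mathbb{D}=\{z\in\mathbb{C}:|z|<1\}$, $d\ge1$, and let ${}^\dagger$ denote the adjoint of a $d\times d$ matrix. A normalized $d\times d$ matrix-valued measure on $\partial\mathbb{D}$ is $d\mu(\theta)=A(\theta)\,d\mu_t(\theta)$, where $d\mu_t$ is a positive scalar measure on $\partial\mathbb{D}$, $A(\theta)\ge0$ and $\operatorname{Tr}A(\theta)=1$ for $\mu_t$-a.e. $\theta$, and $\int A\,d\mu_t=\mathbf{1}$. It is nontrivial if for every $\varphi\in\mathbb{C}^d\setminus\{0\}$ the scalar measure $\langle\varphi,A(\theta)\varphi\rangle\,d\mu_t(\theta)$ is not supported on a finite set. For $d\times d$ matrix-valued functions $f,g$ on $\partial\mathbb{D}$ (square integrable in the obvious sense; in particular for matrix Laurent polynomials) put $$\langle\!\langle f,g\rangle\!\rangle_R=\int f^\dagger(\theta)\,d\mu(\theta)\,g(\theta),\qquad \langle\!\langle f,g\rangle\!\rangle_L=\int g(\theta)\,d\mu(\theta)\,f^\dagger(\theta),$$ which are $d\times d$ matrices. The normalized orthogonal polynomials $\varphi_n^R,\varphi_n^L$ ($n\ge0$) are polynomials in $z$ of degree $n$ with $d\times d$ matrix coefficients, $\varphi_n^{R}(z)=\kappa_n^{R}z^n+\text{lower order}$, $\varphi_n^{L}(z)=\kappa_n^{L}z^n+\text{lower order}$, with $\langle\!\langle\varphi_n^R,\varphi_m^R\rangle\!\rangle_R=\delta_{nm}\mathbf{1}$, $\langle\!\langle\varphi_n^L,\varphi_m^L\rangle\!\rangle_L=\delta_{nm}\mathbf{1}$,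 made unique by $\varphi_0^L=\varphi_0^R=\mathbf{1}$, $\kappa_{n+1}^L(\kappa_n^L)^{-1}>0$ and $(\kappa_n^R)^{-1}\kappa_{n+1}^R>0$. For a matrix polynomial $P_n$ of degree $n$, $P_n^*(z)=z^nP_n(1/\bar z)^\dagger$. The module span of scalar functions $f_1,\dots,f_m$ is the set of functions $\sum_{j=1}^mB_jf_j(z)$ with constant $d\times d$ matrices $B_j$. *)

theory Defs
  imports "HOL-Analysis.Analysis" "HOL-Computational_Algebra.Polynomial"
begin

section \<open>Complex matrices\<close>

definition dagger :: "complex^'n^'m \<Rightarrow> complex^'m^'n"  (\<open>(_\<^sup>\<dagger>)\<close> [1000] 999)
  where "A\<^sup>\<dagger> = (\<chi> i j. cnj (A $ j $ i))"

definition cscale :: "complex \<Rightarrow> complex^'n^'m \<Rightarrow> complex^'n^'m"  (infixr \<open>\<cdot>\<^sub>C\<close> 75)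
  where "c \<cdot>\<^sub>C A = (\<chi> i j. c * A $ i $ j)"

definition cdot :: "complex^'n \<Rightarrow> complex^'n \<Rightarrow> complex"
  where "cdot u v = (\<Sum>i\<in>UNIV. cnj (u $ i) * v $ i)"

definition psd_matrix :: "complex^'n^'n \<Rightarrow> bool"
  where "psd_matrix A \<longleftrightarrow> A\<^sup>\<dagger> = A \<and> (\<forall>v. 0 \<le> Re (cdot v (A *v v)))"

definition pd_matrix :: "complex^'n^'n \<Rightarrow> bool"
  where "pd_matrix A \<longleftrightarrow> A\<^sup>\<dagger> = A \<and> (\<forall>v. v \<noteq> 0 \<longrightarrow> 0 < Re (cdot v (A *v v)))"

section \<open>Matrix-valued measures on the unit circle\<close>

text \<open>The matrix measure \<open>A d\<mu>\<^sub>t\<close> is given by the pair \<open>M\<close> (for \<open>\<mu>\<^sub>t\<close>) and \<open>A\<close>; the point with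
  angle \<open>\<theta>\<close> is the complex number \<open>exp (\<i> \<theta>)\<close>. Finiteness of \<open>M\<close> and integrability of \<open>A\<close>
  need not be required: the Bochner integral of a non-integrable function is 0, so the
  normalization forces \<open>A\<close>, and hence its trace, to be integrable.\<close>

definition normalized_matrix_measure :: "complex measure \<Rightarrow> (complex \<Rightarrow> complex^'d^'d) \<Rightarrow> bool"
  where "normalized_matrix_measure M A \<longleftrightarrow>
    sets M = sets (restrict_space borel (sphere 0 1)) \<and>
    A \<in> borel_measurable M \<and>
    (AE z in M. psd_matrix (A z) \<and> trace (A z) = 1) \<and>
    integral\<^sup>L M A = mat 1"

definition scalar_measure ::
    "complex measure \<Rightarrow> (complex \<Rightarrow> complex^'d^'d) \<Rightarrow> complex^'d \<Rightarrow> complex measure"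
  where "scalar_measure M A v = density M (\<lambda>z. ennreal (Re (cdot v (A z *v v))))"

definition nontrivial_matrix_measure :: "complex measure \<Rightarrow> (complex \<Rightarrow> complex^'d^'d) \<Rightarrow> bool"
  where "nontrivial_matrix_measure M A \<longleftrightarrow>
    (\<forall>v. v \<noteq> 0 \<longrightarrow>
      \<not> (\<exists>F. finite F \<and> emeasure (scalar_measure M A v) (space M - F) = 0))"

definition ip_R :: "complex measure \<Rightarrow> (complex \<Rightarrow> complex^'d^'d) \<Rightarrow>
    (complex \<Rightarrow> complex^'d^'d) \<Rightarrow> (complex \<Rightarrow> complex^'d^'d) \<Rightarrow> complex^'d^'d"
  where "ip_R M A f g = (LINT z|M. (f z)\<^sup>\<dagger> ** A z ** g z)"

definition ip_L :: "complex measure \<Rightarrow> (complex \<Rightarrow> complex^'d^'d) \<Rightarrow>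
    (complex \<Rightarrow> complex^'d^'d) \<Rightarrow> (complex \<Rightarrow> complex^'d^'d) \<Rightarrow> complex^'d^'d"
  where "ip_L M A f g = (LINT z|M. g z ** A z ** (f z)\<^sup>\<dagger>)"

section \<open>Matrix polynomials\<close>

text \<open>Only the coefficients, the degree and the constants of the type \<open>poly\<close> are used. Its evaluation
  \<open>poly\<close> is not, because \<open>*\<close> on the type of vectors is the componentwise product.\<close>

definition mpoly :: "(complex^'d^'d) poly \<Rightarrow> complex \<Rightarrow> complex^'d^'d"
  where "mpoly P z = (\<Sum>k\<le>degree P. z ^ k \<cdot>\<^sub>C coeff P k)"

text \<open>\<open>P\<^sup>*(z) = z\<^sup>n P(1 / cnj z)\<^sup>\<dagger>\<close> with \<open>n\<close> the degree of \<open>P\<close>; meaningful for \<open>z \<noteq> 0\<close>.\<close>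

definition mpoly_star :: "(complex^'d^'d) poly \<Rightarrow> complex \<Rightarrow> complex^'d^'d"
  where "mpoly_star P z = z ^ degree P \<cdot>\<^sub>C (mpoly P (1 / cnj z))\<^sup>\<dagger>"

text \<open>Invertibility of the leading coefficients, needed for \<open>matrix_inv\<close> to be the inverse, follows
  by induction from \<open>p 0 = 1\<close> and the positivity condition.\<close>

definition normalized_OP_R ::
    "complex measure \<Rightarrow> (complex \<Rightarrow> complex^'d^'d) \<Rightarrow> (nat \<Rightarrow> (complex^'d^'d) poly) \<Rightarrow> bool"
  where "normalized_OP_R M A p \<longleftrightarrow>
    (\<forall>n. degree (p n) = n) \<and>
    (\<forall>n m. ip_R M A (mpoly (p n)) (mpoly (p m)) = (if n = m then mat 1 else 0)) \<and>
    p 0 = [:mat 1:] \<and>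
    (\<forall>n. pd_matrix (matrix_inv (coeff (p n) n) ** coeff (p (Suc n)) (Suc n)))"

definition normalized_OP_L ::
    "complex measure \<Rightarrow> (complex \<Rightarrow> complex^'d^'d) \<Rightarrow> (nat \<Rightarrow> (complex^'d^'d) poly) \<Rightarrow> bool"
  where "normalized_OP_L M A p \<longleftrightarrow>
    (\<forall>n. degree (p n) = n) \<and>
    (\<forall>n m. ip_L M A (mpoly (p n)) (mpoly (p m)) = (if n = m then mat 1 else 0)) \<and>
    p 0 = [:mat 1:] \<and>
    (\<forall>n. pd_matrix (coeff (p (Suc n)) (Suc n) ** matrix_inv (coeff (p n) n)))"

section \<open>The CMV and alternate CMV bases\<close>

definition cmv_chi ::
    "(nat \<Rightarrow> (complex^'d^'d) poly) \<Rightarrow> (nat \<Rightarrow> (complex^'d^'d) poly) \<Rightarrow> nat \<Rightarrow> complex \<Rightarrow> complex^'d^'d"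
  where "cmv_chi pL pR l z =
    (if even l then z powi (- int (l div 2)) \<cdot>\<^sub>C mpoly_star (pR l) z
     else z powi (- int ((l + 1) div 2) + 1) \<cdot>\<^sub>C mpoly (pL l) z)"

definition cmv_x ::
    "(nat \<Rightarrow> (complex^'d^'d) poly) \<Rightarrow> (nat \<Rightarrow> (complex^'d^'d) poly) \<Rightarrow> nat \<Rightarrow> complex \<Rightarrow> complex^'d^'d"
  where "cmv_x pL pR l z =
    (if even l then z powi (- int (l div 2)) \<cdot>\<^sub>C mpoly (pL l) z
     else z powi (- int ((l + 1) div 2)) \<cdot>\<^sub>C mpoly_star (pR l) z)"

lemma cmv_chi_even:
  "cmv_chi pL pR (2 * m) z = z powi (- int m) \<cdot>\<^sub>C mpoly_star (pR (2 * m)) z"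
  by (simp add: cmv_chi_def)

lemma cmv_chi_odd:
  assumes "m \<ge> 1"
  shows "cmv_chi pL pR (2 * m - 1) z = z powi (- int m + 1) \<cdot>\<^sub>C mpoly (pL (2 * m - 1)) z"
  using assms by (simp add: cmv_chi_def)

lemma cmv_x_even:
  "cmv_x pL pR (2 * m) z = z powi (- int m) \<cdot>\<^sub>C mpoly (pL (2 * m)) z"
  by (simp add: cmv_x_def)

lemma cmv_x_odd:
  assumes "m \<ge> 1"
  shows "cmv_x pL pR (2 * m - 1) z = z powi (- int m) \<cdot>\<^sub>C mpoly_star (pR (2 * m - 1)) z"
  using assms by (simp add: cmv_x_def)

text \<open>The exponents \<open>0, 1, -1, 2, -2, \<dots>\<close>\<close>

definition cmv_exponent :: "nat \<Rightarrow> int"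
  where "cmv_exponent j = (if even j then - int (j div 2) else int ((j + 1) div 2))"

text \<open>The module span of \<open>f 0, \<dots>, f (m - 1)\<close>, for functions on the punctured plane: Laurent
  polynomials carry no information at \<open>0\<close>, where negative powers take the value \<open>0\<close> in HOL.\<close>

definition module_span ::
    "(nat \<Rightarrow> complex \<Rightarrow> complex) \<Rightarrow> nat \<Rightarrow> (complex \<Rightarrow> complex^'d^'d) set"
  where "module_span f m =
    {g. \<exists>B. \<forall>z. z \<noteq> 0 \<longrightarrow> g z = (\<Sum>j<m. f j z \<cdot>\<^sub>C B j)}"

end

theory Submission
  imports Defs
begin

text \<open>
  Both families consist of Laurent polynomials whose coefficients run through a growing chain of
  exponents: \<open>\<chi>\<^sub>l\<close> uses exactly the first \<open>l + 1\<close> terms of \<open>0, 1, -1, 2, -2, \<dots>\<close>, and \<open>x\<^sub>l\<close> the first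
  \<open>l + 1\<close> terms of the negated sequence. For such a chain, orthonormality amounts to two conditions
  on each member: it has norm one, and it is orthogonal to every monomial that occurs earlier in the
  chain (\<open>lower_orthogonal_imp_orthonormal\<close>). So the proof consists of transporting these conditions
  from the orthogonal polynomials.

  The converse principle \<open>orthonormal_imp_lower_orthogonal\<close> supplies the input: \<open>\<phi>\<^sub>n\<^sup>L\<close> is orthogonal to
  \<open>z\<^sup>k\<close> for \<open>0 \<le> k < n\<close>. The right polynomials enter through the identity \<open>(\<phi>\<^sub>n\<^sup>R)\<^sup>* = z\<^sup>n (\<phi>\<^sub>n\<^sup>R)\<^sup>\<dagger>\<close> on the
  circle. The adjoint exchanges the two inner products, so the functions \<open>(\<phi>\<^sub>n\<^sup>R)\<^sup>\<dagger>\<close> are orthonormal for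
  the left one, with exponents \<open>0, -1, -2, \<dots>\<close>. Hence the same principle makes \<open>(\<phi>\<^sub>n\<^sup>R)\<^sup>\<dagger>\<close>
  orthogonal to \<open>z\<^sup>-\<^sup>k\<close> for \<open>0 \<le> k < n\<close>, and \<open>(\<phi>\<^sub>n\<^sup>R)\<^sup>*\<close> orthogonal to \<open>z, \<dots>, z\<^sup>n\<close>.

  Finally, multiplication by a power of \<open>z\<close> is an isometry. It slides the \<open>n\<close> consecutive exponents
  to which a polynomial is orthogonal along the integers. The powers of \<open>z\<close> in the definitions of
  \<open>\<chi>\<^sub>l\<close> and \<open>x\<^sub>l\<close>, together with the alternation between \<open>\<phi>\<^sup>L\<close> (whose exceptional exponent is the
  highest one) and \<open>(\<phi>\<^sup>R)\<^sup>*\<close> (where it is the lowest one), make the exceptional exponent agree with the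
  newest term of the chain.
\<close>

section \<open>Algebra and continuity of complex matrices\<close>

lemma dagger_dagger [simp]: "(X\<^sup>\<dagger>)\<^sup>\<dagger> = X"
  by (simp add: dagger_def vec_eq_iff)

lemma dagger_mult: "(X ** Y)\<^sup>\<dagger> = Y\<^sup>\<dagger> ** X\<^sup>\<dagger>"
  by (simp add: dagger_def vec_eq_iff matrix_matrix_mult_def mult.commute)

lemma dagger_cscale: "(c \<cdot>\<^sub>C X)\<^sup>\<dagger> = cnj c \<cdot>\<^sub>C X\<^sup>\<dagger>"
  by (simp add: dagger_def cscale_def vec_eq_iff)

lemma dagger_sum: "(\<Sum>i\<in>I. X i)\<^sup>\<dagger> = (\<Sum>i\<in>I. (X i)\<^sup>\<dagger>)"
  by (simp add: dagger_def vec_eq_iff)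

lemma dagger_zero [simp]: "0\<^sup>\<dagger> = 0"
  by (simp add: dagger_def vec_eq_iff)

lemma cscale_mult_left: "(c \<cdot>\<^sub>C X) ** Y = c \<cdot>\<^sub>C (X ** Y)"
  by (simp add: cscale_def vec_eq_iff matrix_matrix_mult_def sum_distrib_left mult.assoc)

lemma cscale_mult_right: "X ** (c \<cdot>\<^sub>C Y) = c \<cdot>\<^sub>C (X ** Y)"
  by (simp add: cscale_def vec_eq_iff matrix_matrix_mult_def sum_distrib_left mult.left_commute)

lemma cscale_cscale: "c \<cdot>\<^sub>C d \<cdot>\<^sub>C X = (c * d) \<cdot>\<^sub>C X"
  by (simp add: cscale_def vec_eq_iff mult.assoc)

lemma cscale_one [simp]: "1 \<cdot>\<^sub>C X = X"
  by (simp add: cscale_def vec_eq_iff)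

lemma cscale_sum: "c \<cdot>\<^sub>C (\<Sum>i\<in>I. X i) = (\<Sum>i\<in>I. c \<cdot>\<^sub>C X i)"
  by (simp add: cscale_def vec_eq_iff sum_distrib_left)

lemma bounded_bilinear_matrix_mult:
  "bounded_bilinear ((**) :: complex^'n^'m \<Rightarrow> complex^'k^'n \<Rightarrow> complex^'k^'m)"
proof -
  have "bilinear ((**) :: complex^'n^'m \<Rightarrow> complex^'k^'n \<Rightarrow> complex^'k^'m)"
    unfolding bilinear_def
    by (intro conjI allI linearI)
       (auto simp: vec_eq_iff matrix_matrix_mult_def algebra_simps sum.distrib scaleR_sum_right)
  then show ?thesis
    by (simp add: bilinear_conv_bounded_bilinear)
qed

lemmas continuous_on_matrix_mult [continuous_intros] =
  bounded_bilinear.continuous_on [OF bounded_bilinear_matrix_mult]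

lemma matrix_mult_zero_right: "X ** 0 = (0 :: complex^'k^'m)"
  by (rule bounded_bilinear.zero_right [OF bounded_bilinear_matrix_mult])

lemma matrix_mult_sum_left: "(\<Sum>i\<in>I. X i) ** Y = (\<Sum>i\<in>I. X i ** (Y :: complex^'k^'n))"
  by (rule bounded_bilinear.sum_left [OF bounded_bilinear_matrix_mult])

lemma continuous_on_dagger [continuous_intros]:
  "continuous_on S f \<Longrightarrow> continuous_on S (\<lambda>z. (f z)\<^sup>\<dagger>)"
  unfolding dagger_def by (intro continuous_intros)

lemma continuous_on_cscale [continuous_intros]:
  "continuous_on S c \<Longrightarrow> continuous_on S f \<Longrightarrow> continuous_on S (\<lambda>z. c z \<cdot>\<^sub>C f z)"
  unfolding cscale_def by (intro continuous_intros)

section \<open>Laurent polynomials with matrix coefficients\<close>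

lemma Laurent_in_module_span:
  assumes "inj_on e {..<m}" "e ` {..<m} = S"
    and "\<And>z. z \<noteq> 0 \<Longrightarrow> g z = (\<Sum>k\<in>S. z powi k \<cdot>\<^sub>C C k)"
  shows "g \<in> module_span (\<lambda>j z. z powi e j) m"
proof -
  have "g z = (\<Sum>j<m. z powi e j \<cdot>\<^sub>C C (e j))" if "z \<noteq> 0" for z
    using assms(3) [OF that] by (simp add: sum.reindex [OF assms(1)] flip: assms(2))
  then show ?thesis
    unfolding module_span_def by (intro CollectI exI [of _ "\<lambda>j. C (e j)"] allI impI)
qed

lemma module_span_continuous_on_circle:
  assumes "g \<in> module_span (\<lambda>j z. z powi e j) m"
  shows "continuous_on (sphere 0 1) g"
proof -
  obtain B where B: "\<And>z. z \<noteq> 0 \<Longrightarrow> g z = (\<Sum>j<m. z powi e j \<cdot>\<^sub>C B j)"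
    using assms unfolding module_span_def by blast
  have "continuous_on (sphere 0 1) (\<lambda>z. \<Sum>j<m. z powi e j \<cdot>\<^sub>C B j)"
    by (intro continuous_intros) auto
  then show ?thesis
    by (rule continuous_on_eq) (auto intro!: B [symmetric])
qed

lemma continuous_on_circle_monomial:
  "continuous_on (sphere 0 1) (\<lambda>z. z powi k \<cdot>\<^sub>C X)"
  by (intro continuous_intros) auto

lemma power_shift_mpoly:
  assumes "z \<noteq> 0"
  shows "z powi a \<cdot>\<^sub>C mpoly P z =
    (\<Sum>k\<in>{a..a + int (degree P)}. z powi k \<cdot>\<^sub>C coeff P (nat (k - a)))"
proof -
  have "z powi a \<cdot>\<^sub>C mpoly P z = (\<Sum>j\<le>degree P. z powi (a + int j) \<cdot>\<^sub>C coeff P j)"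
    using assms by (simp add: mpoly_def cscale_sum cscale_cscale power_int_add)
  also have "\<dots> = (\<Sum>k\<in>{a..a + int (degree P)}. z powi k \<cdot>\<^sub>C coeff P (nat (k - a)))"
    by (rule sum.reindex_bij_witness [of _ "\<lambda>k. nat (k - a)" "\<lambda>j. a + int j"]) auto
  finally show ?thesis .
qed

lemma power_shift_mpoly_star:
  assumes "z \<noteq> 0"
  shows "z powi a \<cdot>\<^sub>C mpoly_star P z =
    (\<Sum>k\<in>{a..a + int (degree P)}. z powi k \<cdot>\<^sub>C (coeff P (nat (a + int (degree P) - k)))\<^sup>\<dagger>)"
proof -
  have pow: "z powi a * (z ^ degree P * (1 / z ^ j)) = z powi (a + int (degree P) - int j)" for j
    using assms by (simp add: power_int_add power_int_diff)
  have "z powi a \<cdot>\<^sub>C mpoly_star P z =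
      (\<Sum>j\<le>degree P. z powi (a + int (degree P) - int j) \<cdot>\<^sub>C (coeff P j)\<^sup>\<dagger>)"
    unfolding mpoly_star_def mpoly_def
    by (simp add: cscale_sum dagger_sum dagger_cscale cscale_cscale power_divide flip: pow)
  also have "\<dots> = (\<Sum>k\<in>{a..a + int (degree P)}.
      z powi k \<cdot>\<^sub>C (coeff P (nat (a + int (degree P) - k)))\<^sup>\<dagger>)"
    by (rule sum.reindex_bij_witness
        [of _ "\<lambda>k. nat (a + int (degree P) - k)" "\<lambda>j. a + int (degree P) - int j"]) auto
  finally show ?thesis .
qed

lemma mpoly_star_on_circle:
  assumes "z \<in> sphere 0 1"
  shows "mpoly_star P z = z ^ degree P \<cdot>\<^sub>C (mpoly P z)\<^sup>\<dagger>"
proof -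
  have "z * cnj z = 1"
    using assms by (simp add: complex_norm_square [symmetric])
  then have "1 / cnj z = z"
    by (metis mult_eq_0_iff nonzero_eq_divide_eq zero_neq_one)
  then show ?thesis
    by (simp add: mpoly_star_def)
qed

section \<open>The left inner product\<close>

context
  fixes M :: "complex measure" and A :: "complex \<Rightarrow> complex^'d^'d"
  assumes normalized: "normalized_matrix_measure M A"
begin

lemma space_eq_circle: "space M = sphere 0 1"
proof -
  have "sets M = sets (restrict_space borel (sphere 0 1))"
    using normalized by (simp add: normalized_matrix_measure_def)
  then have "space M = space (restrict_space borel (sphere 0 1))"
    by (rule sets_eq_imp_space_eq)
  then show ?thesis
    by (simp add: space_restrict_space)
qed

lemma integrable_density: "integrable M A"
proof (rule ccontr)
  assume "\<not> integrable M A"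
  then have "integral\<^sup>L M A = 0"
    by (rule not_integrable_integral_eq)
  then have "(mat 1 :: complex^'d^'d) = 0"
    using normalized by (simp add: normalized_matrix_measure_def)
  then have "(mat 1 :: complex^'d^'d) $ i $ i = 0" for i
    by simp
  then show False
    by (simp add: mat_def)
qed

lemma continuous_on_circle_measurable:
  fixes f :: "complex \<Rightarrow> complex^'n^'m"
  assumes "continuous_on (sphere 0 1) f"
  shows "f \<in> borel_measurable M"
proof -
  have "sets M = sets (restrict_space borel (sphere 0 1))"
    using normalized by (simp add: normalized_matrix_measure_def)
  then show ?thesis
    using borel_measurable_continuous_on_restrict [OF assms] measurable_cong_sets by blast
qed

lemma ip_L_integrable:
  fixes f g :: "complex \<Rightarrow> complex^'d^'d"
  assumes "continuous_on (sphere 0 1) f" "continuous_on (sphere 0 1) g"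
  shows "integrable M (\<lambda>z. g z ** A z ** (f z)\<^sup>\<dagger>)"
proof -
  have bounded: "\<exists>b>0. \<forall>z\<in>sphere 0 1. norm (h z) \<le> b"
    if "continuous_on (sphere 0 1) h" for h :: "complex \<Rightarrow> complex^'d^'d"
    using compact_imp_bounded [OF compact_continuous_image [OF that compact_sphere]]
    by (auto simp: bounded_pos)
  have cf: "continuous_on (sphere 0 1) (\<lambda>z. (f z)\<^sup>\<dagger>)"
    using assms by (intro continuous_intros)
  obtain b where b: "b > 0" "\<And>z. z \<in> sphere 0 1 \<Longrightarrow> norm (g z) \<le> b"
    using bounded [OF assms(2)] by auto
  obtain c where c: "c > 0" "\<And>z. z \<in> sphere 0 1 \<Longrightarrow> norm ((f z)\<^sup>\<dagger>) \<le> c"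
    using bounded [OF cf] by auto
  obtain K where K: "K > 0" "\<And>(X :: complex^'d^'d) (Y :: complex^'d^'d). norm (X ** Y) \<le> norm X * norm Y * K"
    using bounded_bilinear.pos_bounded [OF bounded_bilinear_matrix_mult] by blast
  have meas_mult: "(\<lambda>z. F z ** G z) \<in> borel_measurable M"
    if "F \<in> borel_measurable M" "G \<in> borel_measurable M" for F G :: "complex \<Rightarrow> complex^'d^'d"
    using that by (rule borel_measurable_continuous_Pair) (intro continuous_intros)
  show ?thesis
  proof (rule Bochner_Integration.integrable_bound)
    show "integrable M (\<lambda>z. (b * K * c * K) *\<^sub>R A z)"
      using integrable_density by simp
    show "(\<lambda>z. g z ** A z ** (f z)\<^sup>\<dagger>) \<in> borel_measurable M"
      using assms cf integrable_density
      by (intro meas_mult continuous_on_circle_measurable borel_measurable_integrable)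
    show "AE z in M. norm (g z ** A z ** (f z)\<^sup>\<dagger>) \<le> norm ((b * K * c * K) *\<^sub>R A z)"
    proof (rule AE_I2)
      fix z assume "z \<in> space M"
      then have z: "z \<in> sphere 0 1"
        by (simp add: space_eq_circle)
      have "norm (g z ** A z ** (f z)\<^sup>\<dagger>) \<le> norm (g z ** A z) * norm ((f z)\<^sup>\<dagger>) * K"
        by (rule K(2))
      also have "\<dots> \<le> (norm (g z) * norm (A z) * K) * norm ((f z)\<^sup>\<dagger>) * K"
        using K by (intro mult_right_mono) auto
      also have "\<dots> \<le> (b * norm (A z) * K) * c * K"
        using K b c z by (intro mult_mono) auto
      finally show "norm (g z ** A z ** (f z)\<^sup>\<dagger>) \<le> norm ((b * K * c * K) *\<^sub>R A z)"
        using K b c by (simp add: abs_mult algebra_simps)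
    qed
  qed
qed

lemma ip_L_cong:
  assumes "\<And>z. z \<in> sphere 0 1 \<Longrightarrow> f z = f' z" "\<And>z. z \<in> sphere 0 1 \<Longrightarrow> g z = g' z"
  shows "ip_L M A f g = ip_L M A f' g'"
  unfolding ip_L_def using assms
  by (intro Bochner_Integration.integral_cong) (auto simp: space_eq_circle)

lemma ip_L_Laurent:
  assumes "continuous_on (sphere 0 1) f"
    and "\<And>z. z \<noteq> 0 \<Longrightarrow> g z = (\<Sum>j<m. z powi e j \<cdot>\<^sub>C B j)"
  shows "ip_L M A f g = (\<Sum>j<m. B j ** ip_L M A f (\<lambda>z. z powi e j \<cdot>\<^sub>C mat 1))"
proof -
  have int: "integrable M (\<lambda>z. (z powi e j \<cdot>\<^sub>C mat 1) ** A z ** (f z)\<^sup>\<dagger>)" for j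
    using assms(1) continuous_on_circle_monomial by (rule ip_L_integrable)
  have lin: "bounded_linear (\<lambda>X :: complex^'d^'d. B j ** X)" for j
    by (rule bounded_bilinear.bounded_linear_right [OF bounded_bilinear_matrix_mult])
  have "ip_L M A f g = ip_L M A f (\<lambda>z. \<Sum>j<m. z powi e j \<cdot>\<^sub>C B j)"
    by (rule ip_L_cong) (auto intro!: assms(2))
  also have "\<dots> =
      (LINT z|M. (\<Sum>j<m. B j ** ((z powi e j \<cdot>\<^sub>C mat 1) ** A z ** (f z)\<^sup>\<dagger>)))"
    unfolding ip_L_def
    by (simp add: matrix_mult_sum_left cscale_mult_left cscale_mult_right matrix_mul_assoc)
  also have "\<dots> =
      (\<Sum>j<m. (LINT z|M. B j ** ((z powi e j \<cdot>\<^sub>C mat 1) ** A z ** (f z)\<^sup>\<dagger>)))"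
    by (intro Bochner_Integration.integral_sum integrable_bounded_linear [OF lin] int)
  also have "\<dots> = (\<Sum>j<m. B j ** ip_L M A f (\<lambda>z. z powi e j \<cdot>\<^sub>C mat 1))"
    unfolding ip_L_def by (intro sum.cong refl integral_bounded_linear [OF lin] int)
  finally show ?thesis .
qed

lemma dagger_ip_L:
  assumes "continuous_on (sphere 0 1) f" "continuous_on (sphere 0 1) g"
  shows "(ip_L M A f g)\<^sup>\<dagger> = ip_L M A g f"
proof -
  have lin: "bounded_linear (dagger :: complex^'d^'d \<Rightarrow> complex^'d^'d)"
    by (rule linear_conv_bounded_linear [THEN iffD1], rule linearI)
       (auto simp: dagger_def vec_eq_iff)
  have herm: "AE z in M. (A z)\<^sup>\<dagger> = A z"
    using normalized unfolding normalized_matrix_measure_def psd_matrix_def by auto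
  have "(ip_L M A f g)\<^sup>\<dagger> = (LINT z|M. (g z ** A z ** (f z)\<^sup>\<dagger>)\<^sup>\<dagger>)"
    unfolding ip_L_def by (rule integral_bounded_linear [OF lin ip_L_integrable [OF assms], symmetric])
  also have "\<dots> = ip_L M A g f"
    unfolding ip_L_def
  proof (rule integral_cong_AE)
    show "(\<lambda>z. (g z ** A z ** (f z)\<^sup>\<dagger>)\<^sup>\<dagger>) \<in> borel_measurable M"
      by (intro borel_measurable_integrable integrable_bounded_linear [OF lin] ip_L_integrable assms)
    show "(\<lambda>z. f z ** A z ** (g z)\<^sup>\<dagger>) \<in> borel_measurable M"
      by (intro borel_measurable_integrable ip_L_integrable assms)
    show "AE z in M. (g z ** A z ** (f z)\<^sup>\<dagger>)\<^sup>\<dagger> = f z ** A z ** (g z)\<^sup>\<dagger>"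
      using herm by eventually_elim (simp add: dagger_mult matrix_mul_assoc)
  qed
  finally show ?thesis .
qed

text \<open>On the circle \<open>z\<^sup>a\<close> has modulus one and, being a scalar, commutes with the density.\<close>

lemma ip_L_power_shift:
  "ip_L M A (\<lambda>z. z powi a \<cdot>\<^sub>C f z) (\<lambda>z. z powi a \<cdot>\<^sub>C g z) = ip_L M A f g"
  unfolding ip_L_def
proof (rule Bochner_Integration.integral_cong [OF refl])
  fix z assume "z \<in> space M"
  then have "cmod z = 1"
    by (simp add: space_eq_circle)
  then have "cmod (z powi a) = 1"
    by (simp add: norm_power_int)
  then have "cnj (z powi a) * z powi a = 1"
    by (metis complex_norm_square mult.commute of_real_1 one_power2)
  then show "(z powi a \<cdot>\<^sub>C g z) ** A z ** (z powi a \<cdot>\<^sub>C f z)\<^sup>\<dagger> = g z ** A z ** (f z)\<^sup>\<dagger>"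
    by (simp add: dagger_cscale cscale_mult_left cscale_mult_right cscale_cscale)
qed

lemma ip_L_dagger: "ip_L M A (\<lambda>z. (f z)\<^sup>\<dagger>) (\<lambda>z. (g z)\<^sup>\<dagger>) = ip_R M A g f"
  by (simp add: ip_L_def ip_R_def)

section \<open>Orthonormal families along a chain of exponents\<close>

text \<open>
  Expanding \<open>f k\<close> in the second argument of the inner product with \<open>f n\<close>, where \<open>k \<le> n\<close>, all monomials
  before the \<open>k\<close>-th drop out by induction, so that \<open>\<langle>f n, f k\<rangle>\<close> is the leading coefficient of \<open>f k\<close>
  times \<open>\<langle>f n, z\<^bsup>e k\<^esup>\<rangle>\<close>. For \<open>n = k\<close> this product is the identity, whence the leading coefficient is
  invertible; for \<open>n > k\<close> it vanishes, and the coefficient can be cancelled.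
\<close>

lemma orthonormal_imp_lower_orthogonal:
  assumes span: "\<And>n. f n \<in> module_span (\<lambda>j z. z powi e j) (Suc n)"
    and orth: "\<And>n m. ip_L M A (f n) (f m) = (if n = m then mat 1 else 0)"
    and "k < n"
  shows "ip_L M A (f n) (\<lambda>z. z powi e k \<cdot>\<^sub>C mat 1) = 0"
  using \<open>k < n\<close>
proof (induction k arbitrary: n rule: less_induct)
  case (less k)
  let ?ip = "\<lambda>n j. ip_L M A (f n) (\<lambda>z. z powi e j \<cdot>\<^sub>C mat 1)"
  obtain B where B: "\<And>z. z \<noteq> 0 \<Longrightarrow> f k z = (\<Sum>j<Suc k. z powi e j \<cdot>\<^sub>C B j)"
    using span [of k] unfolding module_span_def by blast
  have leading: "ip_L M A (f n) (f k) = B k ** ?ip n k" if "k \<le> n" for n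
  proof -
    have "ip_L M A (f n) (f k) = (\<Sum>j<Suc k. B j ** ?ip n j)"
      by (rule ip_L_Laurent [OF module_span_continuous_on_circle [OF span] B])
    also have "(\<Sum>j<k. B j ** ?ip n j) = 0"
      using less.IH that by (intro sum.neutral) (auto simp: matrix_mult_zero_right)
    then have "(\<Sum>j<Suc k. B j ** ?ip n j) = B k ** ?ip n k"
      by simp
    finally show ?thesis .
  qed
  have "B k ** ?ip k k = mat 1"
    using leading [of k] orth [of k k] by simp
  then have inv: "?ip k k ** B k = mat 1"
    by (simp add: matrix_left_right_inverse)
  have "B k ** ?ip n k = 0"
    using leading [of n] orth [of n k] less.prems by simp
  then have "?ip k k ** B k ** ?ip n k = 0"
    by (simp add: matrix_mult_zero_right flip: matrix_mul_assoc)
  then show ?case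
    by (simp add: inv)
qed

text \<open>
  Only \<open>\<langle>h n, h m\<rangle>\<close> with \<open>m < n\<close> can be read off by expanding \<open>h m\<close> into monomials; Hermitian symmetry
  covers \<open>n < m\<close>.
\<close>

lemma lower_orthogonal_imp_orthonormal:
  assumes span: "\<And>n. h n \<in> module_span (\<lambda>j z. z powi e j) (Suc n)"
    and norm: "\<And>n. ip_L M A (h n) (h n) = mat 1"
    and lower: "\<And>n j. j < n \<Longrightarrow> ip_L M A (h n) (\<lambda>z. z powi e j \<cdot>\<^sub>C mat 1) = 0"
  shows "ip_L M A (h n) (h m) = (if n = m then mat 1 else 0)"
proof -
  have cont: "continuous_on (sphere 0 1) (h n)" for n
    by (rule module_span_continuous_on_circle [OF span])
  have less: "ip_L M A (h n) (h m) = 0" if "m < n" for m n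
  proof -
    obtain B where B: "\<And>z. z \<noteq> 0 \<Longrightarrow> h m z = (\<Sum>j<Suc m. z powi e j \<cdot>\<^sub>C B j)"
      using span [of m] unfolding module_span_def by blast
    have "ip_L M A (h n) (h m) =
        (\<Sum>j<Suc m. B j ** ip_L M A (h n) (\<lambda>z. z powi e j \<cdot>\<^sub>C mat 1))"
      by (rule ip_L_Laurent [OF cont B])
    also have "\<dots> = 0"
      using that by (intro sum.neutral) (auto simp: lower matrix_mult_zero_right)
    finally show ?thesis .
  qed
  have "ip_L M A (h n) (h m) = 0" if "n < m"
    using less [OF that] dagger_ip_L [OF cont cont, of m n] by simp
  then show ?thesis
    using less norm by (metis nat_neq_iff)
qed

section \<open>Shifted orthogonal polynomials\<close>

lemma shifted_OP_L_orthogonal: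
  assumes "normalized_OP_L M A p" and "k \<in> {a..<a + int n}"
  shows "ip_L M A (\<lambda>z. z powi a \<cdot>\<^sub>C mpoly (p n) z) (\<lambda>z. z powi k \<cdot>\<^sub>C mat 1) = 0"
proof -
  have deg: "degree (p n) = n"
    and orth: "ip_L M A (mpoly (p n)) (mpoly (p m)) = (if n = m then mat 1 else 0)" for n m
    using assms(1) by (auto simp: normalized_OP_L_def)
  have span: "mpoly (p n) \<in> module_span (\<lambda>j z. z powi int j) (Suc n)" for n
    unfolding module_span_def by (auto simp: mpoly_def deg lessThan_Suc_atMost)
  have nonzero: "z \<noteq> 0" if "cmod z = 1" for z
    using that by auto
  define j where "j = nat (k - a)"
  have j: "k = a + int j" "j < n"
    using assms(2) by (auto simp: j_def)
  have "ip_L M A (\<lambda>z. z powi a \<cdot>\<^sub>C mpoly (p n) z) (\<lambda>z. z powi k \<cdot>\<^sub>C mat 1) =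
      ip_L M A (\<lambda>z. z powi a \<cdot>\<^sub>C mpoly (p n) z) (\<lambda>z. z powi a \<cdot>\<^sub>C z powi int j \<cdot>\<^sub>C mat 1)"
    by (rule ip_L_cong) (auto simp: j cscale_cscale power_int_add dest!: nonzero)
  also have "\<dots> = ip_L M A (mpoly (p n)) (\<lambda>z. z powi int j \<cdot>\<^sub>C mat 1)"
    by (rule ip_L_power_shift)
  also have "\<dots> = 0"
    by (rule orthonormal_imp_lower_orthogonal [OF span orth \<open>j < n\<close>])
  finally show ?thesis .
qed

lemma shifted_OP_L_norm:
  assumes "normalized_OP_L M A p"
  shows "ip_L M A (\<lambda>z. z powi a \<cdot>\<^sub>C mpoly (p n) z) (\<lambda>z. z powi a \<cdot>\<^sub>C mpoly (p n) z) = mat 1"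
  using assms by (simp add: ip_L_power_shift normalized_OP_L_def)

text \<open>
  The adjoints of right orthogonal polynomials are represented by \<open>z\<^sup>-\<^sup>n P\<^sup>*\<close>, which agrees with them
  only on the circle but is a Laurent polynomial in \<open>z\<close> on the whole punctured plane.
\<close>

lemma reversed_OP_R_orthonormal:
  assumes "normalized_OP_R M A p"
  shows "ip_L M A (\<lambda>z. z powi (- int n) \<cdot>\<^sub>C mpoly_star (p n) z)
      (\<lambda>z. z powi (- int m) \<cdot>\<^sub>C mpoly_star (p m) z) = (if n = m then mat 1 else 0)"
proof -
  have deg: "degree (p n) = n"
    and orth: "ip_R M A (mpoly (p n)) (mpoly (p m)) = (if n = m then mat 1 else 0)" for n m
    using assms by (auto simp: normalized_OP_R_def)
  have adj: "z powi (- int n) \<cdot>\<^sub>C mpoly_star (p n) z = (mpoly (p n) z)\<^sup>\<dagger>" if "z \<in> sphere 0 1" for z n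
  proof -
    have "z \<noteq> 0"
      using that by auto
    then show ?thesis
      using mpoly_star_on_circle [OF that, of "p n"]
      by (simp add: deg cscale_cscale power_int_minus)
  qed
  have "ip_L M A (\<lambda>z. z powi (- int n) \<cdot>\<^sub>C mpoly_star (p n) z)
      (\<lambda>z. z powi (- int m) \<cdot>\<^sub>C mpoly_star (p m) z) = ip_R M A (mpoly (p m)) (mpoly (p n))"
    unfolding ip_L_dagger [symmetric] by (rule ip_L_cong) (auto intro!: adj)
  then show ?thesis
    using orth [of m n] by auto
qed

lemma shifted_OP_R_orthogonal:
  assumes "normalized_OP_R M A p" and "k \<in> {a<..a + int n}"
  shows "ip_L M A (\<lambda>z. z powi a \<cdot>\<^sub>C mpoly_star (p n) z) (\<lambda>z. z powi k \<cdot>\<^sub>C mat 1) = 0"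
proof -
  let ?f = "\<lambda>n z. z powi (- int n) \<cdot>\<^sub>C mpoly_star (p n) z"
  have deg: "degree (p n) = n" for n
    using assms(1) by (auto simp: normalized_OP_R_def)
  have exps: "(\<lambda>j. - int j) ` {..<Suc n} = {- int n..- int n + int (degree (p n))}" for n
  proof -
    have "k \<in> (\<lambda>j. - int j) ` {..<Suc n}" if "- int n \<le> k" "k \<le> 0" for k
      using that by (intro image_eqI [of _ _ "nat (- k)"]) auto
    then show ?thesis
      by (auto simp: deg)
  qed
  have span: "?f n \<in> module_span (\<lambda>j z. z powi (- int j)) (Suc n)" for n
    by (rule Laurent_in_module_span [OF _ exps power_shift_mpoly_star]) (auto simp: inj_on_def)
  define j where "j = nat (a + int n - k)"
  have j: "k = (a + int n) + (- int j)" "j < n"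
    using assms(2) by (auto simp: j_def)
  have "ip_L M A (\<lambda>z. z powi a \<cdot>\<^sub>C mpoly_star (p n) z) (\<lambda>z. z powi k \<cdot>\<^sub>C mat 1) =
      ip_L M A (\<lambda>z. z powi (a + int n) \<cdot>\<^sub>C ?f n z)
        (\<lambda>z. z powi (a + int n) \<cdot>\<^sub>C z powi (- int j) \<cdot>\<^sub>C mat 1)"
  proof (rule ip_L_cong)
    fix z :: complex assume "z \<in> sphere 0 1"
    then have "z \<noteq> 0"
      by auto
    then have add: "z powi (a + int n) * z powi i = z powi (a + int n + i)" for i
      by (simp add: power_int_add)
    show "z powi a \<cdot>\<^sub>C mpoly_star (p n) z = z powi (a + int n) \<cdot>\<^sub>C ?f n z"
      and "z powi k \<cdot>\<^sub>C mat 1 = z powi (a + int n) \<cdot>\<^sub>C z powi (- int j) \<cdot>\<^sub>C mat 1"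
      by (simp_all add: cscale_cscale add j(1))
  qed
  also have "\<dots> = ip_L M A (?f n) (\<lambda>z. z powi (- int j) \<cdot>\<^sub>C mat 1)"
    by (rule ip_L_power_shift)
  also have "\<dots> = 0"
    by (rule orthonormal_imp_lower_orthogonal
        [OF span reversed_OP_R_orthonormal [OF assms(1)] \<open>j < n\<close>])
  finally show ?thesis .
qed

lemma shifted_OP_R_norm:
  assumes "normalized_OP_R M A p"
  shows "ip_L M A (\<lambda>z. z powi a \<cdot>\<^sub>C mpoly_star (p n) z)
      (\<lambda>z. z powi a \<cdot>\<^sub>C mpoly_star (p n) z) = mat 1"
  using reversed_OP_R_orthonormal [OF assms, of n n] by (simp add: ip_L_power_shift)

end

section \<open>The two orderings of the integers\<close>

lemma inj_cmv_exponent: "inj cmv_exponent"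
proof (rule injI)
  fix i j
  show "cmv_exponent i = cmv_exponent j \<Longrightarrow> i = j"
    unfolding cmv_exponent_def by (cases "even i"; cases "even j"; simp; presburger)
qed

lemma cmv_exponent_image:
  "cmv_exponent ` {..<Suc l} = {- int (l div 2)..int ((l + 1) div 2)}"
proof (induction l)
  case 0
  then show ?case
    by (auto simp: cmv_exponent_def)
next
  case (Suc l)
  have "cmv_exponent ` {..<Suc (Suc l)} =
      insert (cmv_exponent (Suc l)) {- int (l div 2)..int ((l + 1) div 2)}"
    using Suc by (simp add: lessThan_Suc)
  also have "\<dots> = {- int (Suc l div 2)..int ((Suc l + 1) div 2)}"
    by (cases "even l") (auto simp: cmv_exponent_def elim!: evenE oddE)
  finally show ?case .
qed

lemma neg_cmv_exponent_image:
  "(\<lambda>j. - cmv_exponent j) ` {..<Suc l} = {- int ((l + 1) div 2)..int (l div 2)}"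
proof -
  have "(\<lambda>j. - cmv_exponent j) ` {..<Suc l} = uminus ` cmv_exponent ` {..<Suc l}"
    by (simp only: image_image)
  then show ?thesis
    by (simp only: cmv_exponent_image image_uminus_atLeastAtMost) simp
qed

text \<open>
  The \<open>l\<close>-th exponent is an endpoint of the interval filled by the exponents up to \<open>l\<close>: the lower one
  for even \<open>l\<close> and the upper one for odd \<open>l\<close>. The earlier exponents fill the rest.
\<close>

lemma cmv_exponent_earlier:
  assumes "j < l"
  shows "even l \<Longrightarrow> cmv_exponent j \<in> {- int (l div 2)<..int (l div 2)}"
    and "odd l \<Longrightarrow> cmv_exponent j \<in> {- int (l div 2)..<int ((l + 1) div 2)}"
proof -
  have "cmv_exponent j \<in> cmv_exponent ` {..<Suc (l - 1)}"
    using assms by auto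
  then have "cmv_exponent j \<in> {- int ((l - 1) div 2)..int ((l - 1 + 1) div 2)}"
    by (simp only: cmv_exponent_image)
  then show "even l \<Longrightarrow> cmv_exponent j \<in> {- int (l div 2)<..int (l div 2)}"
    and "odd l \<Longrightarrow> cmv_exponent j \<in> {- int (l div 2)..<int ((l + 1) div 2)}"
    using assms by (auto elim!: evenE oddE)
qed

section \<open>The two CMV bases\<close>

theorem proposition4p1:
  fixes M :: "complex measure"
    and A :: "complex \<Rightarrow> complex^'d^'d"
    and pL pR :: "nat \<Rightarrow> (complex^'d^'d) poly"
  assumes "normalized_matrix_measure M A"
    and "nontrivial_matrix_measure M A"
    and "normalized_OP_L M A pL"
    and "normalized_OP_R M A pR"
  shows "(\<forall>l m. ip_L M A (cmv_chi pL pR l) (cmv_chi pL pR m) = (if l = m then mat 1 else 0)) \<and>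
    (\<forall>l m. ip_L M A (cmv_x pL pR l) (cmv_x pL pR m) = (if l = m then mat 1 else 0)) \<and>
    (\<forall>l. cmv_chi pL pR l \<in> module_span (\<lambda>j z. z powi cmv_exponent j) (Suc l)) \<and>
    (\<forall>l. cmv_x pL pR l \<in> module_span (\<lambda>j z. z powi (- cmv_exponent j)) (Suc l))"
proof -
  let ?chi = "cmv_chi pL pR" and ?x = "cmv_x pL pR"
  have deg: "degree (pL l) = l" "degree (pR l) = l" for l
    using assms by (auto simp: normalized_OP_L_def normalized_OP_R_def)
  \<comment> \<open>In both parities the lowest exponent of \<open>\<chi>\<^sub>l\<close> is \<open>- (l div 2)\<close>, and that of \<open>x\<^sub>l\<close> is \<open>- ((l + 1) div 2)\<close>.\<close>
  have chi: "?chi l = (if even l then (\<lambda>z. z powi (- int (l div 2)) \<cdot>\<^sub>C mpoly_star (pR l) z)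
      else (\<lambda>z. z powi (- int (l div 2)) \<cdot>\<^sub>C mpoly (pL l) z))" for l
    by (auto simp: cmv_chi_def fun_eq_iff elim!: oddE)
  have x: "?x l = (if even l then (\<lambda>z. z powi (- int ((l + 1) div 2)) \<cdot>\<^sub>C mpoly (pL l) z)
      else (\<lambda>z. z powi (- int ((l + 1) div 2)) \<cdot>\<^sub>C mpoly_star (pR l) z))" for l
    by (auto simp: cmv_x_def fun_eq_iff elim!: evenE)
  have floor_ceil: "int ((l + 1) div 2) = - int (l div 2) + int l"
    "int (l div 2) = - int ((l + 1) div 2) + int l" for l
    by linarith+
  have chi_span: "?chi l \<in> module_span (\<lambda>j z. z powi cmv_exponent j) (Suc l)" for l
  proof -
    have exps: "cmv_exponent ` {..<Suc l} = {- int (l div 2)..- int (l div 2) + int l}"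
      using cmv_exponent_image [of l] floor_ceil(1) [of l] by simp
    have inj: "inj_on cmv_exponent {..<Suc l}"
      using inj_cmv_exponent by (rule inj_on_subset) simp
    show ?thesis
      using Laurent_in_module_span [OF inj exps power_shift_mpoly [of _ _ "pL l", unfolded deg]]
        Laurent_in_module_span [OF inj exps power_shift_mpoly_star [of _ _ "pR l", unfolded deg]]
      by (cases "even l") (simp_all only: chi if_True if_False simp_thms)
  qed
  have x_span: "?x l \<in> module_span (\<lambda>j z. z powi (- cmv_exponent j)) (Suc l)" for l
  proof -
    have exps: "(\<lambda>j. - cmv_exponent j) ` {..<Suc l} =
        {- int ((l + 1) div 2)..- int ((l + 1) div 2) + int l}"
      using neg_cmv_exponent_image [of l] floor_ceil(2) [of l] by simp
    have inj: "inj_on (\<lambda>j. - cmv_exponent j) {..<Suc l}"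
      using inj_cmv_exponent by (auto simp: inj_on_def)
    show ?thesis
      using Laurent_in_module_span [OF inj exps power_shift_mpoly [of _ _ "pL l", unfolded deg]]
        Laurent_in_module_span [OF inj exps power_shift_mpoly_star [of _ _ "pR l", unfolded deg]]
      by (cases "even l") (simp_all only: x if_True if_False simp_thms)
  qed
  have chi_lower: "ip_L M A (?chi l) (\<lambda>z. z powi cmv_exponent j \<cdot>\<^sub>C mat 1) = 0" if "j < l" for j l
  proof (cases "even l")
    case True
    have "cmv_exponent j \<in> {- int (l div 2)<..- int (l div 2) + int l}"
      using cmv_exponent_earlier(1) [OF that True] by auto
    then show ?thesis
      using True by (simp only: chi if_True shifted_OP_R_orthogonal [OF assms(1,4)])
  next
    case False
    have "cmv_exponent j \<in> {- int (l div 2)..<- int (l div 2) + int l}"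
      using cmv_exponent_earlier(2) [OF that False] floor_ceil(1) [of l] by simp
    then show ?thesis
      using False by (simp only: chi if_False shifted_OP_L_orthogonal [OF assms(1,3)])
  qed
  have x_lower: "ip_L M A (?x l) (\<lambda>z. z powi (- cmv_exponent j) \<cdot>\<^sub>C mat 1) = 0" if "j < l" for j l
  proof (cases "even l")
    case True
    have "- cmv_exponent j \<in> {- int ((l + 1) div 2)..<- int ((l + 1) div 2) + int l}"
      using cmv_exponent_earlier(1) [OF that True] True by (auto elim!: evenE)
    then show ?thesis
      using True by (simp only: x if_True shifted_OP_L_orthogonal [OF assms(1,3)])
  next
    case False
    have "- cmv_exponent j \<in> {- int ((l + 1) div 2)<..- int ((l + 1) div 2) + int l}"
      using cmv_exponent_earlier(2) [OF that False] floor_ceil(2) [of l] by simp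
    then show ?thesis
      using False by (simp only: x if_False shifted_OP_R_orthogonal [OF assms(1,4)])
  qed
  have chi_norm: "ip_L M A (?chi l) (?chi l) = mat 1" for l
    unfolding chi using shifted_OP_L_norm [OF assms(1,3)] shifted_OP_R_norm [OF assms(1,4)] by simp
  have x_norm: "ip_L M A (?x l) (?x l) = mat 1" for l
    unfolding x using shifted_OP_L_norm [OF assms(1,3)] shifted_OP_R_norm [OF assms(1,4)] by simp
  show ?thesis
    using lower_orthogonal_imp_orthonormal [OF assms(1) chi_span chi_norm chi_lower]
      lower_orthogonal_imp_orthonormal [OF assms(1) x_span x_norm x_lower] chi_span x_span
    by blast
qed

end
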